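(* For each $t\ge 1$ and each $k\ge 1$ there exists a $t$-PDDS$[P_k]$ in $\Lambda_2$.
   Context: $\Lambda_2$ is the infinite graph with vertex set $\mathbb{Z}^2$ in which two vertices are adjacent iff their Euclidean distance is $1$; $d$ denotes graph distance. For $S$ a set of vertices, $[S]$ is the induced subgraph and $d(v,C)=\min\{d(v,w):w\in C\}$. For $t\ge1$, $S$ is a $t$-perfect distance-dominating set ($t$-PDDS) if for each vertex $v$ there is a unique component $C_v$ of $[S]$ with $d(v,C_v)\le t$, and there is in $C_v$ a unique vertex $w$ with $d(v,w)=d(v,C_v)$. A $t$-PDDS$[H]$ is a $t$-PDDS all of whose components are isomorphic to the fixed finite graph $H$. $P_k$ is the path on $k$ vertices. *)

theory Defs
  imports
    "HOL-Analysis.Product_Vector"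
    "Graph_Theory.Graph_Theory"
begin

text \<open>
  Simple graphs are modelled as symmetric loop-free digraphs, an edge being a pair of opposite
  arcs. On symmetric digraphs, walks, connectedness and isomorphism of digraphs agree with the
  undirected notions.
\<close>

text \<open>The metric of the product type \<^typ>\<open>real \<times> real\<close> is the Euclidean one.\<close>

definition euclid_dist :: "int \<times> int \<Rightarrow> int \<times> int \<Rightarrow> real" where
  "euclid_dist u v =
     dist (real_of_int (fst u), real_of_int (snd u)) (real_of_int (fst v), real_of_int (snd v))"

definition Lambda2 :: "(int \<times> int) pair_pre_digraph" where
  "Lambda2 = \<lparr> pverts = UNIV, parcs = {(u, v). euclid_dist u v = 1} \<rparr>"

definition path_graph :: "nat \<Rightarrow> nat pair_pre_digraph" where
  "path_graph k =
     \<lparr> pverts = {..<k}, parcs = {(i, j). i < k \<and> j < k \<and> (j = Suc i \<or> i = Suc j)} \<rparr>"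

definition component :: "('a, 'b) pre_digraph \<Rightarrow> ('a, 'b) pre_digraph \<Rightarrow> bool" where
  "component G C \<longleftrightarrow> pre_digraph.max_subgraph G Digraph_Component.connected C"

text \<open>Infimum of the walk lengths: infinite iff there is no walk, attained otherwise.\<close>

definition graph_dist :: "('a, 'b) pre_digraph \<Rightarrow> 'a \<Rightarrow> 'a \<Rightarrow> ereal" where
  "graph_dist G u v = wf_digraph.\<mu> G (\<lambda>_. 1) u v"

text \<open>
  Components are nonempty and the values of \<^const>\<open>graph_dist\<close> are natural numbers or infinity,
  so for a component the infimum is a minimum.
\<close>

definition graph_setdist :: "('a, 'b) pre_digraph \<Rightarrow> 'a \<Rightarrow> 'a set \<Rightarrow> ereal" where
  "graph_setdist G v W = (INF w \<in> W. graph_dist G v w)"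

definition PDDS :: "('a, 'b) pre_digraph \<Rightarrow> nat \<Rightarrow> 'a set \<Rightarrow> bool" where
  "PDDS G t S \<longleftrightarrow>
     S \<subseteq> verts G \<and>
     (\<forall>v \<in> verts G.
        (\<exists>!C. component (G \<restriction> S) C \<and> graph_setdist G v (verts C) \<le> ereal (real t)) \<and>
        (\<forall>C. component (G \<restriction> S) C \<and> graph_setdist G v (verts C) \<le> ereal (real t) \<longrightarrow>
           (\<exists>!w. w \<in> verts C \<and> graph_dist G v w = graph_setdist G v (verts C))))"

definition PDDS_of ::
    "('a, 'b) pre_digraph \<Rightarrow> nat \<Rightarrow> ('c, 'd) pre_digraph \<Rightarrow> 'a set \<Rightarrow> bool" where
  "PDDS_of G t H S \<longleftrightarrow> PDDS G t S \<and> (\<forall>C. component (G \<restriction> S) C \<longrightarrow> digraph_iso C H)"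

lemma euclid_dist_commute: "euclid_dist u v = euclid_dist v u"
  by (simp add: euclid_dist_def dist_commute)

lemma bidirected_Lambda2: "pair_bidirected_digraph Lambda2"
proof unfold_locales
  show "symmetric Lambda2"
    by (auto simp: Lambda2_def symmetric_def euclid_dist_commute intro!: symI)
  show "fst e \<noteq> snd e" if "e \<in> parcs Lambda2" for e
    using that by (auto simp: Lambda2_def euclid_dist_def)
qed (auto simp: Lambda2_def)

lemma graph_path_graph: "pair_graph (path_graph k)"
proof unfold_locales
  show "finite (parcs (path_graph k))"
    by (rule finite_subset[of _ "{..<k} \<times> {..<k}"]) (auto simp: path_graph_def)
qed (auto simp: path_graph_def symmetric_def intro!: symI)

end

theory Submission
  imports Defs
begin

text \<open>
  Take all components to be horizontal segments of \<open>k\<close> vertices whose left ends form the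
  lattice \<open>L\<close> generated by \<open>(t + k, t)\<close> and \<open>(1, 2 t + 1)\<close>. The set of vertices at distance at
  most \<open>t\<close> from a segment is a diamond stretched horizontally; it has \<open>N = 2 t\<^sup>2 + 2 t k + k\<close>
  elements, which is the index of \<open>L\<close>, and its translates by \<open>L\<close> tile the plane. Concretely, \<open>L\<close>
  is the kernel of \<open>(x, y) \<mapsto> (2 t + 1) x - y\<close> modulo \<open>N\<close>, and this map is a bijection from the
  diamond onto the residues. The nearest vertex of a segment is unique, being obtained by
  clamping the first coordinate; and different segments are at distance at least \<open>2 t + 1\<close>,
  hence not adjacent.
\<close>

section \<open>Components of a graph covered by connected, arc-closed vertex sets\<close>

lemma induce_induce_subgraph:
  assumes "T \<subseteq> S"
  shows "(G \<restriction> S) \<restriction> T = G \<restriction> T"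
  using assms by (auto simp: induce_subgraph_def)

lemma connected_subset_of_arc_closed:
  assumes con: "Digraph_Component.connected D" and v: "v \<in> verts D" "v \<in> P"
    and closed: "\<And>e. e \<in> arcs D \<Longrightarrow> tail D e \<in> P \<longleftrightarrow> head D e \<in> P"
  shows "verts D \<subseteq> P"
proof
  fix w assume "w \<in> verts D"
  with con v(1) have "(v, w) \<in> rtrancl_on (verts D) ((arcs_ends D)\<^sup>s)"
    by (auto simp: connected_conv)
  then show "w \<in> P"
  proof (induct rule: rtrancl_on_induct)
    case base
    show ?case by (rule v(2))
  next
    case (step b c)
    then show ?case using closed by (auto simp: arcs_ends_conv symcl_def)
  qed
qed

text \<open>A connected subgraph that meets some \<open>P i\<close> cannot leave it, since no arc
  crosses its boundary, and so lies below \<open>G \<restriction> P i\<close>. Hence each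
  \<open>G \<restriction> P i\<close> is maximal, and every maximal connected subgraph is one of
  them.\<close>

lemma component_iff_of_cover:
  assumes G: "wf_digraph G"
    and cover: "verts G = (\<Union>i\<in>I. P i)"
    and con: "\<And>i. i \<in> I \<Longrightarrow> Digraph_Component.connected (G \<restriction> P i)"
    and closed: "\<And>i e. i \<in> I \<Longrightarrow> e \<in> arcs G \<Longrightarrow> tail G e \<in> P i \<longleftrightarrow> head G e \<in> P i"
  shows "component G C \<longleftrightarrow> (\<exists>i\<in>I. C = G \<restriction> P i)"
proof -
  interpret wf_digraph G by (rule G)
  have sub: "P i \<subseteq> verts G" if "i \<in> I" for i
    using cover that by blast
  have within: "subgraph D (G \<restriction> P i)"
    if D: "subgraph D G" "Digraph_Component.connected D" and v: "v \<in> verts D" "v \<in> P i" and i: "i \<in> I"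
    for D v i
  proof -
    have "verts D \<subseteq> P i"
      using D v closed[OF i]
      by (intro connected_subset_of_arc_closed) (auto simp: subgraph_def compatible_def)
    moreover have "wf_digraph D"
      using D by (simp add: subgraph_def)
    ultimately show ?thesis
      using D by (auto simp: subgraph_def compatible_def intro: wf_digraph.wellformed)
  qed
  \<comment> \<open>A subgraph has the same tail and head functions as the whole graph, so mutual
    inclusion of vertices and arcs gives equality of the records.\<close>
  have antisym: "D = E" if "subgraph D E" "subgraph E D" for D E :: "('a, 'b) pre_digraph"
    using that by (intro pre_digraph.equality) (auto simp: subgraph_def compatible_def)
  have ind: "subgraph (G \<restriction> P i) G" if "i \<in> I" for i
    using sub[OF that] by (auto intro: induced_imp_subgraph)
  show ?thesis
  proof
    assume "component G C"
    then have C: "subgraph C G" "Digraph_Component.connected C"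
      and max: "\<And>H. subgraph C H \<Longrightarrow> subgraph H G \<Longrightarrow> Digraph_Component.connected H \<Longrightarrow> H = C"
      by (auto simp: component_def max_subgraph_def)
    from C obtain v where v: "v \<in> verts C" "v \<in> verts G"
      by (auto simp: connected_conv subgraph_def)
    then obtain i where i: "i \<in> I" "v \<in> P i"
      using cover by auto
    then show "\<exists>i\<in>I. C = G \<restriction> P i"
      using max[OF within[OF C v(1)] ind con] by blast
  next
    assume "\<exists>i\<in>I. C = G \<restriction> P i"
    then obtain i where i: "i \<in> I" and C: "C = G \<restriction> P i" by blast
    have "H = C" if H: "subgraph C H" "subgraph H G" "Digraph_Component.connected H" for H
    proof -
      obtain v where "v \<in> P i"
        using con[OF i] by (auto simp: connected_conv)
      with H(1) C have "v \<in> verts H" by (auto simp: subgraph_def)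
      from within[OF H(2,3) this \<open>v \<in> P i\<close> i] H(1) show ?thesis
        unfolding C by (rule antisym)
    qed
    then show "component G C"
      using ind con i by (auto simp: component_def max_subgraph_def C)
  qed
qed

section \<open>Graph distance in the square grid\<close>

definition manhattan :: "int \<times> int \<Rightarrow> int \<times> int \<Rightarrow> int" where
  "manhattan u v = \<bar>fst u - fst v\<bar> + \<bar>snd u - snd v\<bar>"

lemma manhattan_eq_0_iff: "manhattan u v = 0 \<longleftrightarrow> u = v"
  by (auto simp: manhattan_def prod_eq_iff)

lemma arc_Lambda2_iff: "(u, v) \<in> parcs Lambda2 \<longleftrightarrow> manhattan u v = 1"
proof -
  obtain a b c d where uv: "u = (a, b)" "v = (c, d)" by (cases u, cases v)
  have "(u, v) \<in> parcs Lambda2 \<longleftrightarrow> (of_int a - of_int c)\<^sup>2 + (of_int b - of_int d)\<^sup>2 = (1::real)"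
    by (simp add: Lambda2_def euclid_dist_def dist_prod_def dist_real_def uv)
  also have "\<dots> \<longleftrightarrow> real_of_int ((a - c)\<^sup>2 + (b - d)\<^sup>2) = real_of_int 1"
    by simp
  also have "\<dots> \<longleftrightarrow> (a - c)\<^sup>2 + (b - d)\<^sup>2 = 1"
    by (subst of_int_eq_iff) simp
  also have "\<dots> \<longleftrightarrow> \<bar>a - c\<bar> + \<bar>b - d\<bar> = 1"
  proof -
    \<comment> \<open>Passing to squares never decreases an integer and fixes only 0 and 1, so sums
      of two squares and of two absolute values reach 1 simultaneously.\<close>
    have sq: "m\<^sup>2 = m \<longleftrightarrow> m = 0 \<or> m = 1" "m \<le> m\<^sup>2" for m :: int
      by (auto simp: power2_eq_square)
        (smt (verit) mult_le_cancel_left1 mult_nonneg_nonneg mult_nonpos_nonpos)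
    have "m\<^sup>2 + n\<^sup>2 = 1 \<longleftrightarrow> m + n = 1" if "m \<ge> 0" "n \<ge> 0" for m n :: int
      using that sq[of m] sq[of n] zero_le_power2[of m] zero_le_power2[of n]
      by (smt (verit) zero_power2 one_power2)
    from this[of "\<bar>a - c\<bar>" "\<bar>b - d\<bar>"] show ?thesis by simp
  qed
  finally show ?thesis by (simp add: manhattan_def uv)
qed

interpretation Lambda2: pair_bidirected_digraph Lambda2
  by (rule bidirected_Lambda2)

lemma awalk_Lambda2_ge: "Lambda2.awalk u p v \<Longrightarrow> manhattan u v \<le> int (length p)"
proof (induct p arbitrary: u)
  case Nil
  then show ?case by (simp add: Lambda2.awalk_Nil_iff manhattan_def)
next
  case (Cons e p)
  then have "e \<in> parcs Lambda2" "u = fst e" "Lambda2.awalk (snd e) p v"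
    by (auto simp: Lambda2.awalk_Cons_iff)
  with Cons(1)[of "snd e"] show ?case
    using arc_Lambda2_iff[of "fst e" "snd e"] by (auto simp: manhattan_def)
qed

lemma awalk_Lambda2_exists: "\<exists>p. Lambda2.awalk u p v \<and> int (length p) = manhattan u v"
proof (induct "nat (manhattan u v)" arbitrary: u)
  case 0
  then have "u = v"
    using manhattan_eq_0_iff[of u v] by (auto simp: manhattan_def)
  then show ?case
    by (intro exI[of _ "[]"]) (simp add: Lambda2.awalk_Nil_iff manhattan_def, simp add: Lambda2_def)
next
  case (Suc n)
  \<comment> \<open>The next vertex of a shortest walk to \<open>v\<close>: horizontal steps first,
    vertical ones once the first coordinates agree.\<close>
  define w where "w = (if fst u = fst v then (fst u, snd u + sgn (snd v - snd u))
                       else (fst u + sgn (fst v - fst u), snd u))"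
  have "u \<noteq> v"
    using Suc(2) manhattan_eq_0_iff[of u v] by auto
  then have uw: "manhattan u w = 1" and wv: "manhattan u v = manhattan w v + 1"
    by (auto simp: w_def manhattan_def sgn_if prod_eq_iff)
  from Suc(2) wv have "n = nat (manhattan w v)" by simp
  from Suc(1)[OF this] obtain p where "Lambda2.awalk w p v" "int (length p) = manhattan w v"
    by blast
  then show ?case
    using uw wv
    by (intro exI[of _ "(u, w) # p"]) (auto simp: Lambda2.awalk_Cons_iff arc_Lambda2_iff)
qed

lemma graph_dist_Lambda2: "graph_dist Lambda2 u v = ereal (of_int (manhattan u v))"
proof -
  have cost: "Lambda2.awalk_cost (\<lambda>_. 1) p = real (length p)" for p
    by (simp add: Lambda2.awalk_cost_def sum_list_triv)
  show ?thesis
    unfolding graph_dist_def Lambda2.\<mu>_def cost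
  proof (rule INF_eqI)
    fix p assume "p \<in> {p. Lambda2.awalk u p v}"
    then show "ereal (of_int (manhattan u v)) \<le> ereal (real (length p))"
      using awalk_Lambda2_ge[of u p v] by simp
  next
    fix y assume y: "\<And>p. p \<in> {p. Lambda2.awalk u p v} \<Longrightarrow> y \<le> ereal (real (length p))"
    obtain p where "Lambda2.awalk u p v" "int (length p) = manhattan u v"
      using awalk_Lambda2_exists by blast
    with y[of p] show "y \<le> ereal (of_int (manhattan u v))" 
      by (metis mem_Collect_eq of_int_of_nat_eq)
  qed
qed

section \<open>Arithmetic of the lattice: packing and covering\<close>

text \<open>Here \<open>(p, q)\<close> stands for the difference of the left ends of two segments
  that have vertices at distance at most \<open>2 * t\<close>. Write
  \<open>(2 * t + 1) * p - q = j * N\<close>. Up to sign \<open>j \<ge> 0\<close>; the bounds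
  exclude \<open>j \<ge> 1\<close>, and \<open>j = 0\<close> forces the zero vector.\<close>

lemma tile_lattice_packing:
  fixes t k p q N :: int
  assumes t: "t \<ge> 0" and k: "k \<ge> 1" and N: "N = (2 * t + 1) * (t + k) - t"
    and dvd: "N dvd (2 * t + 1) * p - q"
    and close: "\<bar>q\<bar> \<le> 2 * t" "\<bar>p\<bar> + \<bar>q\<bar> \<le> 2 * t + k - 1"
  shows "p = 0 \<and> q = 0"
proof -
  have "(2 * t + 1) * (t + k) \<ge> 1 * (t + k)"
    using t k by (intro mult_right_mono) auto
  then have "N > 0" using k by (simp add: N)
  have main: "j \<le> 0"
    if j: "(2 * t + 1) * p - q = j * N"
      and close: "\<bar>q\<bar> \<le> 2 * t" "\<bar>p\<bar> + \<bar>q\<bar> \<le> 2 * t + k - 1"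
    for j p q :: int
  proof (rule ccontr)
    assume "\<not> j \<le> 0"
    \<comment> \<open>The first coordinate of \<open>(p, q) - j * (t + k, t)\<close>, a vector on
      which the linear form vanishes because \<open>(t + k, t)\<close> has value
      \<open>N\<close>.\<close>
    define r where "r = p - j * (t + k)"
    have r: "(2 * t + 1) * r = q - j * t"
      using j by (simp add: r_def N algebra_simps)
    show False
    proof (cases "j = 1")
      case True
      have "(2 * t + 1) * r < (2 * t + 1) * 1" "(2 * t + 1) * (-2) < (2 * t + 1) * r"
        unfolding r using True close t by auto
      then have "r < 1" "-2 < r"
        using t by (simp_all only: mult_less_cancel_left)
      \<comment> \<open>These cases are the lattice vectors \<open>(t + k, t)\<close> and
        \<open>(t + k - 1, - t - 1)\<close>, both of Manhattan length \<open>2 * t + k\<close>, one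
        more than allowed.\<close>
      then have "r = 0 \<or> r = -1" by auto
      then show False
        using r close True t by (auto simp: r_def)
    next
      case False
      with \<open>\<not> j \<le> 0\<close> have j2: "j \<ge> 2" by simp
      \<comment> \<open>For \<open>j \<ge> 2\<close> the value \<open>j * N\<close> is out of reach
        of so small a \<open>p\<close>.\<close>
      have "p \<le> 2 * t + k - 1" using close by simp
      then have "(2 * t + 1) * p \<le> (2 * t + 1) * (2 * t + k - 1)"
        using t by (intro mult_left_mono) auto
      also have "\<dots> = 2 * N - (2 * t + 1) * k - 1"
        by (simp add: N algebra_simps)
      also have "\<dots> < 2 * N - 2 * t"
        using mult_nonneg_nonneg[of "2 * t + 1" "k - 1"] t k by (simp add: algebra_simps)
      also have "\<dots> \<le> j * N - 2 * t"
        using \<open>N > 0\<close> j2 by simp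
      also have "\<dots> \<le> (2 * t + 1) * p"
        using j close by linarith
      finally show False by simp
    qed
  qed
  from dvd obtain j where j: "(2 * t + 1) * p - q = j * N"
    by (metis dvd_def mult.commute)
  have "j \<le> 0" using main[OF j close] .
  \<comment> \<open>The bounds are invariant under negating \<open>(p, q)\<close>, which negates
    \<open>j\<close>.\<close>
  moreover have "- j \<le> 0"
    by (rule main[of "- p" "- q"]) (use j close in \<open>auto simp: algebra_simps\<close>)
  ultimately have "q = (2 * t + 1) * p" using j by auto
  moreover have "p = 0"
  proof (rule ccontr)
    assume "p \<noteq> 0"
    then have "(2 * t + 1) * 1 \<le> (2 * t + 1) * \<bar>p\<bar>"
      using t by (intro mult_left_mono) auto
    also have "\<dots> = \<bar>q\<bar>" using \<open>q = _\<close> t by (simp add: abs_mult)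
    finally show False using close by simp
  qed
  ultimately show ?thesis by simp
qed

text \<open>The inequalities describe the diamond around the segment from \<open>(0, 0)\<close> to
  \<open>(k - 1, 0)\<close>. Division with remainder by \<open>2 * t + 1\<close> writes each residue
  as a value of the linear form on the strip \<open>\<bar>y\<bar> \<le> t\<close>; points outside
  the diamond are then moved into it.\<close>

lemma tile_lattice_covering:
  fixes t k m N :: int
  assumes t: "t \<ge> 0" and k: "k \<ge> 1" and N: "N = (2 * t + 1) * (t + k) - t"
  shows "\<exists>x y. N dvd m - ((2 * t + 1) * x - y) \<and> \<bar>y\<bar> \<le> t \<and> \<bar>y\<bar> - t \<le> x \<and> x \<le> k - 1 + t - \<bar>y\<bar>"
proof -
  have "(2 * t + 1) * (t + k) \<ge> 1 * (t + k)"
    using t k by (intro mult_right_mono) auto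
  then have "N > 0" using k by (simp add: N)
  \<comment> \<open>The shift by \<open>t\<close> centres the remainders
    \<open>0, ..., 2 * t\<close>, so that they become ordinates between \<open>- t\<close> and
    \<open>t\<close>.\<close>
  define n where "n = (m + t) mod N"
  have n: "0 \<le> n" "n < N" using \<open>N > 0\<close> by (auto simp: n_def)
  have dvd: "N dvd m - (n - t)"
    using mod_eq_dvd_iff[of "m + t" N n] by (simp add: n_def algebra_simps)
  define x where "x = n div (2 * t + 1)"
  define y where "y = t - n mod (2 * t + 1)"
  have nxy: "n - t = (2 * t + 1) * x - y"
    unfolding x_def y_def using mult_div_mod_eq[of "2 * t + 1" n] by linarith
  have y: "\<bar>y\<bar> \<le> t"
    using pos_mod_bound[of "2 * t + 1" n] pos_mod_sign[of "2 * t + 1" n] t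
    unfolding y_def by linarith
  have x0: "x \<ge> 0"
    unfolding x_def using n t by (intro pos_imp_zdiv_nonneg_iff[THEN iffD2]) auto
  have "(2 * t + 1) * x < (2 * t + 1) * (t + k)"
    using nxy n y N by linarith
  then have xlt: "x < t + k"
    using t by (simp only: mult_less_cancel_left)
  \<comment> \<open>The vertex \<open>(x, y)\<close> may stick out of the diamond on the right; then it is moved back by the
    lattice vector \<open>(t + k, t)\<close> or \<open>(t + k - 1, - t - 1)\<close>.\<close>
  consider "x \<le> k - 1 + t - \<bar>y\<bar>" | "x \<ge> k + t - \<bar>y\<bar>" "y \<ge> 0" | "x \<ge> k + t - \<bar>y\<bar>" "y < 0"
    by linarith
  then show ?thesis
  proof cases
    case 1
    then show ?thesis using dvd y x0 unfolding nxy by (intro exI[of _ x] exI[of _ y]) auto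
  next
    case 2
    have "m - ((2 * t + 1) * (x - t - k) - (y - t)) = (m - (n - t)) + N"
      unfolding nxy N by (simp add: algebra_simps)
    then have "N dvd m - ((2 * t + 1) * (x - t - k) - (y - t))"
      using dvd by (simp only: dvd_add_triv_right_iff)
    then show ?thesis
      using 2 y xlt k by (intro exI[of _ "x - t - k"] exI[of _ "y - t"]) auto
  next
    case 3
    have "m - ((2 * t + 1) * (x - t - k + 1) - (y + t + 1)) = (m - (n - t)) + N"
      unfolding nxy N by (simp add: algebra_simps)
    then have "N dvd m - ((2 * t + 1) * (x - t - k + 1) - (y + t + 1))"
      using dvd by (simp only: dvd_add_triv_right_iff)
    then show ?thesis
      using 3 y xlt k by (intro exI[of _ "x - t - k + 1"] exI[of _ "y + t + 1"]) auto
  qed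
qed

section \<open>Segments as paths, and nearest vertices on them\<close>

definition seg :: "nat \<Rightarrow> int \<times> int \<Rightarrow> (int \<times> int) set" where
  "seg k c = (\<lambda>i. (fst c + int i, snd c)) ` {..<k}"

lemma mem_seg_iff: "w \<in> seg k c \<longleftrightarrow> fst c \<le> fst w \<and> fst w < fst c + int k \<and> snd w = snd c"
  by (auto simp: seg_def prod_eq_iff image_iff intro!: bexI[of _ "nat (fst w - fst c)"])

text \<open>Induction links each vertex to the left end \<open>p 0\<close>; symmetry and
  transitivity then link any two vertices.\<close>

lemma connected_seg:
  assumes "k \<ge> 1"
  shows "Digraph_Component.connected (with_proj Lambda2 \<restriction> seg k c)"
proof -
  define G where "G = with_proj Lambda2 \<restriction> seg k c"
  define R where "R = rtrancl_on (verts G) ((arcs_ends G)\<^sup>s)"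
  define p where "p i = (fst c + int i, snd c)" for i
  have verts: "verts G = p ` {..<k}"
    by (simp add: G_def seg_def p_def)
  have R: "(p 0, p i) \<in> R" if "i < k" for i
    using that
  proof (induct i)
    case 0
    then show ?case unfolding R_def by (intro rtrancl_on_refl) (auto simp: verts)
  next
    case (Suc i)
    have "(p i, p (Suc i)) \<in> arcs_ends G"
      using Suc(2)
      by (auto simp: G_def arcs_ends_conv arc_Lambda2_iff manhattan_def p_def mem_seg_iff
          intro!: image_eqI[of _ _ "(p i, p (Suc i))"])
    then have "(p i, p (Suc i)) \<in> (arcs_ends G)\<^sup>s"
      by (auto simp: symcl_def)
    moreover have "p (Suc i) \<in> verts G"
      using Suc(2) by (auto simp: verts)
    ultimately show ?case
      using Suc unfolding R_def by (auto intro: rtrancl_on_into_rtrancl_on)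
  qed
  have "sym ((arcs_ends G)\<^sup>s)"
    by (auto simp: symcl_def sym_def)
  then have "sym R"
    unfolding R_def by (rule rtrancl_on_sym)
  then have "(p i, p j) \<in> R" if "i < k" "j < k" for i j
    using R[OF that(1)] R[OF that(2)] unfolding R_def
    by (meson rtrancl_on_trans symD)
  then show ?thesis
    using assms unfolding G_def[symmetric] connected_conv R_def[symmetric]
    by (auto simp: verts lessThan_empty_iff)
qed

lemma digraph_iso_seg: "digraph_iso (with_proj Lambda2 \<restriction> seg k c) (with_proj (path_graph k))"
proof -
  \<comment> \<open>The offset from the left end, with inverse \<open>p\<close> on the segment;
    offsets there are nonnegative, so \<open>nat\<close> loses nothing.\<close>
  define f where "f w = nat (fst w - fst c)" for w :: "int \<times> int"
  define p where "p i = (fst c + int i, snd c)" for i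
  define h where "h = \<lparr>iso_verts = f, iso_arcs = map_prod f f, iso_head = snd, iso_tail = fst\<rparr>"
  have fp: "f (p i) = i" for i by (simp add: f_def p_def)
  have pf: "p (f w) = w" if "w \<in> seg k c" for w
    using that by (auto simp: f_def p_def mem_seg_iff prod_eq_iff)
  have inj: "inj_on f (seg k c)"
    by (metis pf inj_onI)
  have verts: "f ` seg k c = {..<k}"
    by (auto simp: seg_def image_image fp[unfolded p_def])
  have arcs: "map_prod f f ` {e \<in> parcs Lambda2. fst e \<in> seg k c \<and> snd e \<in> seg k c}
      = parcs (path_graph k)" (is "?L = ?R")
  proof (intro equalityI subsetI)
    fix e assume "e \<in> ?L"
    then show "e \<in> ?R"
      by (auto simp: path_graph_def arc_Lambda2_iff mem_seg_iff manhattan_def f_def)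
  next
    fix e assume e: "e \<in> ?R"
    then have "e = map_prod f f (map_prod p p e)"
      by (cases e) (simp add: fp)
    moreover have "map_prod p p e \<in> {e \<in> parcs Lambda2. fst e \<in> seg k c \<and> snd e \<in> seg k c}"
      using e by (auto simp: path_graph_def arc_Lambda2_iff mem_seg_iff manhattan_def p_def)
    ultimately show "e \<in> ?L" by (rule image_eqI)
  qed
  have "inj_on (map_prod f f) {e \<in> parcs Lambda2. fst e \<in> seg k c \<and> snd e \<in> seg k c}"
    by (rule inj_on_subset[OF map_prod_inj_on[OF inj inj]]) auto
  moreover have "wf_digraph (with_proj Lambda2 \<restriction> seg k c)"
    by (rule Lambda2.wellformed_induce_subgraph)
  ultimately have "pre_digraph.digraph_isomorphism (with_proj Lambda2 \<restriction> seg k c) h"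
    using inj by (auto simp: pre_digraph.digraph_isomorphism_def h_def)
  moreover have "with_proj (path_graph k) = app_iso h (with_proj Lambda2 \<restriction> seg k c)"
    using verts arcs
    by (intro pre_digraph.equality) (auto simp: h_def path_graph_def)
  ultimately show ?thesis
    unfolding digraph_iso_def by blast
qed

definition seg_proj :: "nat \<Rightarrow> int \<times> int \<Rightarrow> int \<times> int \<Rightarrow> int \<times> int" where
  "seg_proj k c v = (max (fst c) (min (fst c + int k - 1) (fst v)), snd c)"

lemma seg_proj_in_seg: "k \<ge> 1 \<Longrightarrow> seg_proj k c v \<in> seg k c"
  by (auto simp: seg_proj_def mem_seg_iff)

text \<open>The vertical part of the distance is the same for all vertices of the segment, and
  clamping is the unique minimizer of the horizontal part. Strictness yields both the set distance
  and the uniqueness of the nearest vertex.\<close>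

lemma manhattan_seg_proj_less:
  assumes "w \<in> seg k c" "w \<noteq> seg_proj k c v"
  shows "manhattan v (seg_proj k c v) < manhattan v w"
  using assms by (auto simp: seg_proj_def mem_seg_iff manhattan_def prod_eq_iff)

lemma graph_setdist_seg:
  assumes "k \<ge> 1"
  shows "graph_setdist Lambda2 v (seg k c) = ereal (of_int (manhattan v (seg_proj k c v)))"
  unfolding graph_setdist_def graph_dist_Lambda2
proof (rule INF_eqI)
  fix w assume "w \<in> seg k c"
  then show "ereal (of_int (manhattan v (seg_proj k c v))) \<le> ereal (of_int (manhattan v w))"
    using manhattan_seg_proj_less[of w k c v] by (cases "w = seg_proj k c v") auto
qed (use seg_proj_in_seg[OF assms] in blast)

lemma nearest_in_seg:
  assumes "k \<ge> 1"
  shows "\<exists>!w. w \<in> seg k c \<and> graph_dist Lambda2 v w = graph_setdist Lambda2 v (seg k c)"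
  unfolding graph_setdist_seg[OF assms] graph_dist_Lambda2
proof (rule ex1I[of _ "seg_proj k c v"])
  show "w = seg_proj k c v"
    if "w \<in> seg k c \<and> ereal (of_int (manhattan v w)) = ereal (of_int (manhattan v (seg_proj k c v)))"
    for w
    using that manhattan_seg_proj_less[of w k c v] by auto
qed (simp add: seg_proj_in_seg[OF assms])

section \<open>The tiling by lattice translates\<close>

text \<open>The modulus is \<open>2 t\<^sup>2 + 2 t k + k\<close>, the size of the \<open>t\<close>-neighbourhood of a segment.\<close>

definition tile_lattice :: "nat \<Rightarrow> nat \<Rightarrow> (int \<times> int) set" where
  "tile_lattice t k = {c. (2 * int t + 1) * (int t + int k) - int t dvd (2 * int t + 1) * fst c - snd c}"

text \<open>Offsets within two segments differ by at most \<open>k - 1\<close>, so the left ends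
  satisfy the bounds of \<open>tile_lattice_packing\<close>. Distances 0, 1 and \<open>2 * t\<close>
  give disjointness, non-adjacency and uniqueness of the nearby segment respectively.\<close>

lemma segs_far_apart:
  assumes "k \<ge> 1" and cd: "c \<in> tile_lattice t k" "d \<in> tile_lattice t k"
    and uw: "u \<in> seg k c" "w \<in> seg k d" "manhattan u w \<le> 2 * int t"
  shows "c = d"
proof -
  have "(2 * int t + 1) * (int t + int k) - int t dvd
      (2 * int t + 1) * (fst c - fst d) - (snd c - snd d)"
    using dvd_diff[OF cd[unfolded tile_lattice_def mem_Collect_eq]] by (simp add: algebra_simps)
  moreover have "\<bar>snd c - snd d\<bar> \<le> 2 * int t"
      "\<bar>fst c - fst d\<bar> + \<bar>snd c - snd d\<bar> \<le> 2 * int t + int k - 1"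
    using uw by (auto simp: mem_seg_iff manhattan_def)
  ultimately have "fst c - fst d = 0 \<and> snd c - snd d = 0"
    using assms(1) by (intro tile_lattice_packing[OF _ _ refl]) auto
  then show ?thesis by (simp add: prod_eq_iff)
qed

lemma seg_near_every_vertex:
  assumes "k \<ge> 1"
  shows "\<exists>c \<in> tile_lattice t k. manhattan v (seg_proj k c v) \<le> int t"
proof -
  let ?N = "(2 * int t + 1) * (int t + int k) - int t"
  obtain x y where xy:
    "?N dvd ((2 * int t + 1) * fst v - snd v) - ((2 * int t + 1) * x - y)"
    "\<bar>y\<bar> \<le> int t" "\<bar>y\<bar> - int t \<le> x" "x \<le> int k - 1 + int t - \<bar>y\<bar>"
    using tile_lattice_covering[of "int t" "int k" ?N "(2 * int t + 1) * fst v - snd v"] assms by auto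
  \<comment> \<open>The left end for which \<open>v\<close> has offset \<open>(x, y)\<close>; the
    choice of residue puts it in the lattice, and the diamond bounds put \<open>v\<close> near its
    segment.\<close>
  let ?c = "(fst v - x, snd v - y)"
  have "?c \<in> tile_lattice t k"
    using xy(1) by (simp add: tile_lattice_def algebra_simps)
  moreover have "manhattan v (seg_proj k ?c v) \<le> int t"
    using xy assms by (auto simp: manhattan_def seg_proj_def)
  ultimately show ?thesis by blast
qed

lemma component_segs_iff:
  assumes "t \<ge> 1" "k \<ge> 1"
  shows "component (with_proj Lambda2 \<restriction> (\<Union>c\<in>tile_lattice t k. seg k c)) C
    \<longleftrightarrow> (\<exists>c\<in>tile_lattice t k. C = with_proj Lambda2 \<restriction> seg k c)"
    (is "component (_ \<restriction> ?S) C \<longleftrightarrow> _")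
proof -
  have ind: "(with_proj Lambda2 \<restriction> ?S) \<restriction> seg k c = with_proj Lambda2 \<restriction> seg k c"
    if "c \<in> tile_lattice t k" for c
    using that by (intro induce_induce_subgraph) auto
  have same: "u \<in> seg k c \<longleftrightarrow> w \<in> seg k c"
    if "manhattan u w = 1" "u \<in> ?S" "w \<in> ?S" "c \<in> tile_lattice t k" for u w c
  proof -
    obtain a b where ab: "a \<in> tile_lattice t k" "b \<in> tile_lattice t k" "u \<in> seg k a" "w \<in> seg k b"
      using \<open>u \<in> ?S\<close> \<open>w \<in> ?S\<close> by blast
    \<comment> \<open>Here \<open>t \<ge> 1\<close> enters: adjacent vertices are at distance
      \<open>1 \<le> 2 * t\<close>.\<close>
    have "a = b"
      using segs_far_apart[OF assms(2) ab] that assms by simp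
    moreover have "x \<in> seg k c \<Longrightarrow> x \<in> seg k a \<Longrightarrow> c = a" for x
      using segs_far_apart[OF assms(2) that(4) ab(1), of x x] by (simp add: manhattan_def)
    ultimately show ?thesis using ab by blast
  qed
  have "component (with_proj Lambda2 \<restriction> ?S) C
      \<longleftrightarrow> (\<exists>c\<in>tile_lattice t k. C = (with_proj Lambda2 \<restriction> ?S) \<restriction> seg k c)"
  proof (rule component_iff_of_cover)
    fix c e
    assume "c \<in> tile_lattice t k" "e \<in> arcs (with_proj Lambda2 \<restriction> ?S)"
    then show "tail (with_proj Lambda2 \<restriction> ?S) e \<in> seg k c
        \<longleftrightarrow> head (with_proj Lambda2 \<restriction> ?S) e \<in> seg k c"
      using same[of "fst e" "snd e" c] arc_Lambda2_iff[of "fst e" "snd e"] by simp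
  qed (auto simp: ind connected_seg[OF assms(2)] Lambda2.wellformed_induce_subgraph)
  then show ?thesis using ind by auto
qed

theorem theorem8:
  fixes t k :: nat
  assumes "t \<ge> 1" and "k \<ge> 1"
  shows "\<exists>S :: (int \<times> int) set. PDDS_of Lambda2 t (path_graph k) S"
proof -
  let ?S = "\<Union>c\<in>tile_lattice t k. seg k c"
  note comp = component_segs_iff[OF assms]
  have ex: "\<exists>!C. component (with_proj Lambda2 \<restriction> ?S) C
      \<and> graph_setdist Lambda2 v (verts C) \<le> ereal (real t)" for v
  proof -
    obtain c where c: "c \<in> tile_lattice t k" "manhattan v (seg_proj k c v) \<le> int t"
      using seg_near_every_vertex[OF assms(2)] by blast
    have uniq: "d = c" if d: "d \<in> tile_lattice t k" "manhattan v (seg_proj k d v) \<le> int t" for d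
    proof (rule segs_far_apart[OF assms(2) d(1) c(1)])
      \<comment> \<open>Triangle inequality through \<open>v\<close>.\<close>
      show "manhattan (seg_proj k d v) (seg_proj k c v) \<le> 2 * int t"
        using c(2) d(2) by (simp add: manhattan_def)
    qed (rule seg_proj_in_seg[OF assms(2)])+
    have le: "graph_setdist Lambda2 v (seg k d) \<le> ereal (real t)
        \<longleftrightarrow> manhattan v (seg_proj k d v) \<le> int t" for d
      unfolding graph_setdist_seg[OF assms(2)] by simp linarith
    show ?thesis
    proof (rule ex1I[of _ "with_proj Lambda2 \<restriction> seg k c"])
      fix C
      assume "component (with_proj Lambda2 \<restriction> ?S) C
        \<and> graph_setdist Lambda2 v (verts C) \<le> ereal (real t)"
      then obtain d where d: "d \<in> tile_lattice t k" "C = with_proj Lambda2 \<restriction> seg k d"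
        and "graph_setdist Lambda2 v (verts C) \<le> ereal (real t)"
        unfolding comp by blast
      then have "manhattan v (seg_proj k d v) \<le> int t"
        unfolding le[symmetric] by simp
      then show "C = with_proj Lambda2 \<restriction> seg k c"
        using uniq d by blast
    next
      have "component (with_proj Lambda2 \<restriction> ?S) (with_proj Lambda2 \<restriction> seg k c)"
        unfolding comp using c(1) by blast
      then show "component (with_proj Lambda2 \<restriction> ?S) (with_proj Lambda2 \<restriction> seg k c)
        \<and> graph_setdist Lambda2 v (verts (with_proj Lambda2 \<restriction> seg k c)) \<le> ereal (real t)"
        using c(2) by (simp add: le)
    qed
  qed
  have near: "\<exists>!w. w \<in> verts C \<and> graph_dist Lambda2 v w = graph_setdist Lambda2 v (verts C)"
    if "component (with_proj Lambda2 \<restriction> ?S) C" for v C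
  proof -
    from that obtain c where "verts C = seg k c"
      unfolding comp by auto
    then show ?thesis
      using nearest_in_seg[OF assms(2)] by simp
  qed
  have "?S \<subseteq> verts Lambda2"
    by (simp add: Lambda2_def)
  then have "PDDS Lambda2 t ?S"
    unfolding PDDS_def
    by (intro conjI ballI allI impI) (assumption, rule ex, rule near, erule conjunct1)
  moreover have "\<forall>C. component (with_proj Lambda2 \<restriction> ?S) C \<longrightarrow> digraph_iso C (path_graph k)"
    unfolding comp using digraph_iso_seg by blast
  ultimately show ?thesis
    unfolding PDDS_of_def by blast
qed

end
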